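(* Let $G$ be a finite group, $N$ a normal subgroup, $\pi_N:G\to G/N$ the natural projection, and $\pi_N^*:\mathrm{Map}(G/N,\mathbb{C})\to\mathrm{Map}(G,\mathbb{C})$ the map $\pi_N^*(f)=f\circ\pi_N$. Let $\phi_1,\dots,\phi_{k'}$ be all the irreducible complex characters of $G/N$. Let $$F(N)=\{\chi\in\mathrm{Cha}(G)\mid \chi(g)=\chi(e)\ \text{for all } g\in N\}.$$ Suppose $\chi\in F(N)$ and $\chi'\in\mathrm{Cha}(G/N)$ satisfy $\chi=\pi_N^*(\chi')$. Then: (1) $\lambda^i(\chi)$ and $S^i(\chi)$ belong to $F(N)$ for every $i\ge1$. (2) For all $i=0,1,2,\dots$ and $j=1,\dots,k'$, $$\langle\pi_N^*(\phi_j),S^i(\chi)\rangle_G=\langle\phi_j,S^i(\chi')\rangle_{G/N},\qquad \langle\pi_N^*(\phi_j),\lambda^i(\chi)\rangle_G=\langle\phi_j,\lambda^i(\chi')\rangle_{G/N}.$$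
   Context: For a finite group $G$, $\mathrm{Cha}(G)$ is the set of all characters of finite-dimensional complex representations of $G$, including the zero function as the character of the $0$-dimensional representation. $\mathrm{Map}(G,\mathbb{C})$ is the commutative $\mathbb{C}$-algebra of all functions $G\to\mathbb{C}$ with pointwise operations. Adams operations: $\psi^n(f)(g)=f(g^n)$ for $n\ge1$. The $\lambda$-operations $\lambda^i$ ($i\ge 0$) on $\mathrm{Map}(G,\mathbb{C})$ are defined by letting $\lambda_t(f)=\sum_{i\ge0}\lambda^i(f)t^i$ be the unique formal power series over $\mathrm{Map}(G,\mathbb{C})$ with constant term $1$ satisfying $\sum_{n\ge1}\psi^n(f)(-t)^n=-t\,\bigl(\tfrac{d}{dt}\lambda_t(f)\bigr)\lambda_t(f)^{-1}$. The symmetric power operations $S^i$ are defined by $S_t(f)=\sum_{i\ge0}S^i(f)t^i=(\lambda_{-t}(f))^{-1}$. (If $\chi$ is the character of a finite-dimensional complex representation $V$, then $\lambda^i(\chi)$ and $S^i(\chi)$ are the characters of $\bigwedge^i V$ and $S^i(V)$.) The same definitions apply to $G/N$. Inner product: $\langle f,f'\rangle_G=\frac1{|G|}\sum_{g\in G}f(g)f'(g^{-1})$. *)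

theory Defs
  imports
    "HOL-Algebra.Coset"
    "HOL-Library.Function_Algebras"
    "HOL-Library.Indicator_Function"
    "HOL-Computational_Algebra.Formal_Power_Series"
    "Jordan_Normal_Form.VS_Connect"
begin

text \<open>
  A function from a group to the complex numbers is represented by a total function on the
  ambient type that is 0 off the carrier. Sums, products and powers of such functions are
  the pointwise ones. The unit of this algebra is the indicator of the carrier, not the
  constant function 1 on the whole type.
\<close>

definition Maps :: "('a, 'm) monoid_scheme \<Rightarrow> ('a \<Rightarrow> complex) set" where
  "Maps G = {f. \<forall>x. x \<notin> carrier G \<longrightarrow> f x = 0}"

definition unit_map :: "('a, 'm) monoid_scheme \<Rightarrow> ('a \<Rightarrow> complex)" where
  "unit_map G = indicator (carrier G)"

definition inner_prod ::
    "('a, 'm) monoid_scheme \<Rightarrow> ('a \<Rightarrow> complex) \<Rightarrow> ('a \<Rightarrow> complex) \<Rightarrow> complex" where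
  "inner_prod G f f' =
     (1 / of_nat (card (carrier G))) * (\<Sum>g\<in>carrier G. f g * f' (inv\<^bsub>G\<^esub> g))"

subsection \<open>Characters\<close>

text \<open>
  Up to isomorphism, a finite-dimensional complex representation is a homomorphism to
  the group of invertible complex matrices of size \<open>n\<close>; \<open>n = 0\<close> is allowed.
\<close>

definition GL :: "nat \<Rightarrow> complex mat monoid" where
  "GL n = units_of (ring_mat TYPE(complex) n ())"

definition mat_trace :: "complex mat \<Rightarrow> complex" where
  "mat_trace A = (\<Sum>i<dim_row A. A $$ (i, i))"

definition character_of ::
    "('a, 'm) monoid_scheme \<Rightarrow> ('a \<Rightarrow> complex mat) \<Rightarrow> ('a \<Rightarrow> complex)" where
  "character_of G \<rho> = (\<lambda>g. if g \<in> carrier G then mat_trace (\<rho> g) else 0)"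

definition Cha :: "('a, 'm) monoid_scheme \<Rightarrow> ('a \<Rightarrow> complex) set" where
  "Cha G = {character_of G \<rho> |n \<rho>. \<rho> \<in> hom G (GL n)}"

definition irreducible_rep ::
    "('a, 'm) monoid_scheme \<Rightarrow> nat \<Rightarrow> ('a \<Rightarrow> complex mat) \<Rightarrow> bool" where
  "irreducible_rep G n \<rho> \<longleftrightarrow>
     \<rho> \<in> hom G (GL n) \<and> n > 0 \<and>
     (\<forall>W. subspace class_ring W (module_vec TYPE(complex) n) \<and>
          (\<forall>g\<in>carrier G. \<forall>v\<in>W. \<rho> g *\<^sub>v v \<in> W) \<longrightarrow>
          W = {0\<^sub>v n} \<or> W = carrier_vec n)"

definition Irr :: "('a, 'm) monoid_scheme \<Rightarrow> ('a \<Rightarrow> complex) set" where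
  "Irr G = {character_of G \<rho> |n \<rho>. irreducible_rep G n \<rho>}"

subsection \<open>Power series, Adams operations, exterior and symmetric powers\<close>

definition Maps_fps :: "('a, 'm) monoid_scheme \<Rightarrow> ('a \<Rightarrow> complex) fps set" where
  "Maps_fps G = {L. \<forall>n. fps_nth L n \<in> Maps G}"

definition series_inverse ::
    "('a, 'm) monoid_scheme \<Rightarrow> ('a \<Rightarrow> complex) fps \<Rightarrow> ('a \<Rightarrow> complex) fps" where
  "series_inverse G L = (THE M. M \<in> Maps_fps G \<and> L * M = fps_const (unit_map G))"

definition adams ::
    "('a, 'm) monoid_scheme \<Rightarrow> nat \<Rightarrow> ('a \<Rightarrow> complex) \<Rightarrow> ('a \<Rightarrow> complex)" where
  "adams G n f = (\<lambda>g. if g \<in> carrier G then f (g [^]\<^bsub>G\<^esub> n) else 0)"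

definition adams_series ::
    "('a, 'm) monoid_scheme \<Rightarrow> ('a \<Rightarrow> complex) \<Rightarrow> ('a \<Rightarrow> complex) fps" where
  "adams_series G f = Abs_fps (\<lambda>n. if n = 0 then 0 else (- 1) ^ n * adams G n f)"

definition is_lambda_series ::
    "('a, 'm) monoid_scheme \<Rightarrow> ('a \<Rightarrow> complex) \<Rightarrow> ('a \<Rightarrow> complex) fps \<Rightarrow> bool" where
  "is_lambda_series G f L \<longleftrightarrow>
     L \<in> Maps_fps G \<and> fps_nth L 0 = unit_map G \<and>
     adams_series G f = - fps_X * fps_deriv L * series_inverse G L"

definition lambda_series ::
    "('a, 'm) monoid_scheme \<Rightarrow> ('a \<Rightarrow> complex) \<Rightarrow> ('a \<Rightarrow> complex) fps" where
  "lambda_series G f = (THE L. is_lambda_series G f L)"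

definition lambda_op ::
    "('a, 'm) monoid_scheme \<Rightarrow> nat \<Rightarrow> ('a \<Rightarrow> complex) \<Rightarrow> ('a \<Rightarrow> complex)" where
  "lambda_op G i f = fps_nth (lambda_series G f) i"

definition sym_series ::
    "('a, 'm) monoid_scheme \<Rightarrow> ('a \<Rightarrow> complex) \<Rightarrow> ('a \<Rightarrow> complex) fps" where
  "sym_series G f = series_inverse G (lambda_series G f oo (- fps_X))"

definition sym_op ::
    "('a, 'm) monoid_scheme \<Rightarrow> nat \<Rightarrow> ('a \<Rightarrow> complex) \<Rightarrow> ('a \<Rightarrow> complex)" where
  "sym_op G i f = fps_nth (sym_series G f) i"

subsection \<open>Quotients\<close>

definition proj :: "('a, 'm) monoid_scheme \<Rightarrow> 'a set \<Rightarrow> 'a \<Rightarrow> 'a set" where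
  "proj G N g = N #>\<^bsub>G\<^esub> g"

definition pullback ::
    "('a, 'm) monoid_scheme \<Rightarrow> 'a set \<Rightarrow> ('a set \<Rightarrow> complex) \<Rightarrow> ('a \<Rightarrow> complex)" where
  "pullback G N f = (\<lambda>g. if g \<in> carrier G then f (proj G N g) else 0)"

definition F :: "('a, 'm) monoid_scheme \<Rightarrow> 'a set \<Rightarrow> ('a \<Rightarrow> complex) set" where
  "F G N = {\<chi> \<in> Cha G. \<forall>g\<in>N. \<chi> g = \<chi> \<one>\<^bsub>G\<^esub>}"

subsection \<open>The definite descriptions are well defined\<close>

lemma unit_map_in_Maps: "unit_map G \<in> Maps G"
  by (simp add: Maps_def unit_map_def)

lemma unit_map_mult: "f \<in> Maps G \<Longrightarrow> unit_map G * f = f"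
  by (auto simp: Maps_def unit_map_def indicator_def fun_eq_iff)

lemma Maps_mult: "f \<in> Maps G \<Longrightarrow> g * f \<in> Maps G"
  by (auto simp: Maps_def)

lemma Maps_uminus: "f \<in> Maps G \<Longrightarrow> - f \<in> Maps G"
  by (auto simp: Maps_def)

lemma Maps_sum: "(\<And>i. i \<in> I \<Longrightarrow> h i \<in> Maps G) \<Longrightarrow> sum h I \<in> Maps G"
  by (induction I rule: infinite_finite_induct) (auto simp: Maps_def)

lemma sum_pointwise: "sum h I x = (\<Sum>i\<in>I. h i x :: complex)"
  by (induction I rule: infinite_finite_induct) auto

lemma Maps_fps_mult: "L \<in> Maps_fps G \<Longrightarrow> K * L \<in> Maps_fps G"
  by (auto simp: Maps_fps_def fps_mult_nth intro!: Maps_sum Maps_mult)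

lemma unit_map_fps_mult: "L \<in> Maps_fps G \<Longrightarrow> fps_const (unit_map G) * L = L"
  by (rule fps_ext) (simp add: Maps_fps_def unit_map_mult)

lemma series_inverse_ex1:
  assumes "L \<in> Maps_fps G" and L0: "fps_nth L 0 = unit_map G"
  shows "\<exists>!M. M \<in> Maps_fps G \<and> L * M = fps_const (unit_map G)"
proof (rule ex_ex1I)
  let ?u = "unit_map G"
  have u: "?u \<in> Maps G" by (rule unit_map_in_Maps)
  define M where "M = fps_right_inverse L ?u"
  have M0: "fps_nth M 0 = ?u" by (simp add: M_def)
  have Mn: "fps_nth M n = - ?u * (\<Sum>i=1..n. fps_nth L i * fps_nth M (n - i))" if "n > 0" for n
    unfolding M_def fps_nth_Abs_fps using that by (rule fps_right_inverse_constructor_rec)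
  have "fps_nth M n \<in> Maps G" for n
  proof (cases "n = 0")
    case False
    have "- ?u * s \<in> Maps G" for s
      using Maps_mult[OF Maps_uminus[OF u], of s] by (simp add: mult.commute)
    with False Mn[of n] show ?thesis by simp
  qed (simp add: M0 u)
  moreover have "L * M = fps_const ?u"
  proof (rule fps_ext)
    fix n
    show "fps_nth (L * M) n = fps_nth (fps_const ?u) n"
    proof (cases "n = 0")
      case True
      then show ?thesis by (simp add: L0 M0 unit_map_mult u)
    next
      case False
      let ?s = "\<Sum>i=1..n. fps_nth L i * fps_nth M (n - i)"
      have s: "?s \<in> Maps G"
        using calculation by (intro Maps_sum Maps_mult)
      have "fps_nth (L * M) n = ?u * fps_nth M n + ?s"
        using False by (simp add: fps_mult_nth sum.atLeast_Suc_atMost L0)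
      also have "\<dots> = 0"
        using False s by (simp add: Mn unit_map_mult Maps_uminus)
      finally show ?thesis using False by simp
    qed
  qed
  ultimately show "\<exists>M. M \<in> Maps_fps G \<and> L * M = fps_const ?u"
    by (auto simp: Maps_fps_def)
next
  fix M M'
  assume 1: "M \<in> Maps_fps G \<and> L * M = fps_const (unit_map G)"
    and 2: "M' \<in> Maps_fps G \<and> L * M' = fps_const (unit_map G)"
  have "M = (L * M') * M" using 1 2 unit_map_fps_mult by metis
  also have "\<dots> = (L * M) * M'" by (simp add: ac_simps)
  also have "\<dots> = M'" using 1 2 unit_map_fps_mult by metis
  finally show "M = M'" .
qed

lemma series_inverse:
  assumes "L \<in> Maps_fps G" "fps_nth L 0 = unit_map G"
  shows "series_inverse G L \<in> Maps_fps G"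
    and "L * series_inverse G L = fps_const (unit_map G)"
  using theI'[OF series_inverse_ex1[OF assms]] unfolding series_inverse_def by auto

lemma adams_series_in_Maps_fps: "adams_series G f \<in> Maps_fps G"
  by (auto simp: adams_series_def Maps_fps_def adams_def Maps_def)

lemma is_lambda_series_iff:
  "is_lambda_series G f L \<longleftrightarrow>
     L \<in> Maps_fps G \<and> fps_nth L 0 = unit_map G \<and>
     adams_series G f * L = - fps_X * fps_deriv L"
proof -
  have "adams_series G f = - fps_X * fps_deriv L * series_inverse G L \<longleftrightarrow>
        adams_series G f * L = - fps_X * fps_deriv L"
    if L: "L \<in> Maps_fps G" "fps_nth L 0 = unit_map G"
  proof -
    let ?u = "fps_const (unit_map G)" and ?I = "series_inverse G L"
    have "fps_nth (- fps_X * fps_deriv L) n \<in> Maps G" for n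
      using L(1) by (cases n) (auto simp: Maps_fps_def Maps_def)
    then have D: "- fps_X * fps_deriv L \<in> Maps_fps G" by (simp add: Maps_fps_def)
    note inv = series_inverse[OF L]
    show ?thesis
    proof
      assume "adams_series G f = - fps_X * fps_deriv L * ?I"
      then have "adams_series G f * L = (L * ?I) * (- fps_X * fps_deriv L)"
        by (simp add: ac_simps)
      then show "adams_series G f * L = - fps_X * fps_deriv L"
        by (simp only: inv unit_map_fps_mult[OF D])
    next
      assume "adams_series G f * L = - fps_X * fps_deriv L"
      then have "- fps_X * fps_deriv L * ?I = (L * ?I) * adams_series G f"
        by (metis mult.commute mult.assoc)
      then show "adams_series G f = - fps_X * fps_deriv L * ?I"
        by (simp only: inv unit_map_fps_mult[OF adams_series_in_Maps_fps])
    qed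
  qed
  then show ?thesis unfolding is_lambda_series_def by blast
qed

lemma lambda_series_ex1: "\<exists>!L. is_lambda_series G f L"
proof (rule ex_ex1I)
  let ?P = "adams_series G f"
  define step where
    "step = (\<lambda>l n x. if n = 0 then unit_map G x
       else - (\<Sum>k=1..n. fps_nth ?P k x * l (n - k) x) / of_nat n)"
  define l where "l = wfrec less_than step"
  have l: "l n = (\<lambda>x. if n = 0 then unit_map G x
       else - (\<Sum>k=1..n. fps_nth ?P k x * l (n - k) x) / of_nat n)" for n
    unfolding l_def by (subst wfrec[OF wf_less_than]) (auto simp: step_def cut_def fun_eq_iff)
  define L where "L = Abs_fps l"
  have "l n x = 0" if "x \<notin> carrier G" for n x
    using that adams_series_in_Maps_fps[of G f]
    by (subst l) (auto simp: unit_map_def Maps_fps_def Maps_def)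
  then have "L \<in> Maps_fps G" by (simp add: L_def Maps_fps_def Maps_def)
  moreover have "fps_nth L 0 = unit_map G" by (simp add: L_def l)
  moreover have "?P * L = - fps_X * fps_deriv L"
  proof (rule fps_ext, rule ext)
    fix n x
    have P0: "fps_nth ?P 0 = 0" by (simp add: adams_series_def)
    show "fps_nth (?P * L) n x = fps_nth (- fps_X * fps_deriv L) n x"
    proof (cases n)
      case (Suc m)
      have "fps_nth (?P * L) n x = (\<Sum>k=1..n. fps_nth ?P k x * l (n - k) x)"
        using P0 by (simp add: fps_mult_nth sum.atLeast_Suc_atMost L_def Suc sum_pointwise
          del: sum.atLeast0_atMost_Suc)
      also have "\<dots> = - of_nat n * l n x" using Suc by (subst (2) l) (simp del: of_nat_Suc)
      finally show ?thesis using Suc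
        by (simp add: L_def of_nat_fun algebra_simps del: of_nat_Suc)
    qed (simp add: P0)
  qed
  ultimately show "\<exists>L. is_lambda_series G f L" unfolding is_lambda_series_iff by blast
next
  fix L L'
  assume "is_lambda_series G f L" "is_lambda_series G f L'"
  let ?P = "adams_series G f"
  have rec: "of_nat n * fps_nth K n x = - (\<Sum>k=1..n. fps_nth ?P k x * fps_nth K (n - k) x)"
    if "is_lambda_series G f K" "n > 0" for K n x
  proof -
    obtain m where m: "n = Suc m" using \<open>n > 0\<close> by (cases n) auto
    have P0: "fps_nth ?P 0 = 0" by (simp add: adams_series_def)
    have "fps_nth (?P * K) n x = fps_nth (- fps_X * fps_deriv K) n x"
      using that by (simp add: is_lambda_series_iff)
    moreover have "fps_nth (?P * K) n x = (\<Sum>k=1..n. fps_nth ?P k x * fps_nth K (n - k) x)"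
      using P0 m by (simp add: fps_mult_nth sum.atLeast_Suc_atMost sum_pointwise
        del: sum.atLeast0_atMost_Suc)
    moreover have "fps_nth (- fps_X * fps_deriv K) n x = - of_nat n * fps_nth K n x"
      using m by (simp add: of_nat_fun algebra_simps del: of_nat_Suc)
    ultimately show ?thesis by simp
  qed
  have "fps_nth L n = fps_nth L' n" for n
  proof (induction n rule: less_induct)
    case (less n)
    show ?case
    proof (cases "n = 0")
      case False
      show ?thesis
      proof
        fix x
        have "of_nat n * fps_nth L n x = of_nat n * fps_nth L' n x"
          using False less
          by (simp add: rec[OF \<open>is_lambda_series G f L\<close>] rec[OF \<open>is_lambda_series G f L'\<close>])
        then show "fps_nth L n x = fps_nth L' n x" using False by simp
      qed
    qed (use \<open>is_lambda_series G f L\<close> \<open>is_lambda_series G f L'\<close>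
      in \<open>simp add: is_lambda_series_def\<close>)
  qed
  then show "L = L'" by (rule fps_ext)
qed

lemma lambda_series: "is_lambda_series G f (lambda_series G f)"
  unfolding lambda_series_def by (rule theI'[OF lambda_series_ex1])

end

theory Submission
  imports
    Defs
    "HOL-Combinatorics.Permutations"
    "Jordan_Normal_Form.Gauss_Jordan_Elimination"
begin

text \<open>
  At a fixed group element the defining identities of \<open>\<lambda>\<^sub>t\<close> and \<open>S\<^sub>t\<close> become Newton's recursion, so
  \<open>\<lambda>\<^sup>i(f)(g)\<close> and \<open>S\<^sup>i(f)(g)\<close> depend only on the values \<open>f(g\<^sup>j)\<close>. Hence both operations commute
  with pullback along the projection, and the inner products agree because all fibres of the
  projection have \<open>|N|\<close> elements.

  That \<open>\<lambda>\<^sup>i(\<chi>)\<close> and \<open>S\<^sup>i(\<chi>)\<close> are characters is seen on the \<open>i\<close>-th tensor power of a representation: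
  its compression by the (anti)symmetrizer is multiplicative, and an idempotent splits, which turns
  the compression into an honest representation with the same trace. Removing one point from a
  cycle of a permutation shows that this trace satisfies Newton's recursion, too.
\<close>

section \<open>Splitting idempotent matrices\<close>

text \<open>Gauss-Jordan elimination yields a rank factorization \<open>A = U V\<close> in which
  \<open>U\<close> has a left inverse \<open>L\<close> and \<open>V\<close> a right inverse
  \<open>W\<close>; cancelling both in \<open>U V U V = U V\<close> leaves
  \<open>V U = 1\<close>.\<close>

lemma idempotent_mat_split:
  fixes A :: "'a :: field mat"
  assumes A: "A \<in> carrier_mat d d" and idem: "A * A = A"
  obtains r U V where "U \<in> carrier_mat d r" "V \<in> carrier_mat r d" "U * V = A" "V * U = 1\<^sub>m r"
proof -
  define C where "C = gauss_jordan_single A"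
  note gj = gauss_jordan_single[OF A C_def[symmetric]]
  have C: "C \<in> carrier_mat d d" by (rule gj(2))
  from gj(4) obtain T S where CT: "C = T * A" and T: "T \<in> carrier_mat d d"
    and S: "S \<in> carrier_mat d d" and TS: "T * S = 1\<^sub>m d" and ST: "S * T = 1\<^sub>m d" by blast
  from gj(3) C obtain f where "pivot_fun C f d" by (auto simp: row_echelon_form_def)
  note piv = pivot_funD[OF carrier_matD(1)[OF C] this]
  have SC: "S * C = A" using A S T ST unfolding CT by (simp flip: assoc_mult_mat)
  \<comment> \<open>The pivot function takes the default value \<open>d\<close> exactly on zero
    rows, so \<open>R\<close> collects the nonzero rows of \<open>C\<close> and \<open>r\<close> is
    the rank.\<close>
  define R where "R = {i. i < d \<and> f i < d}"
  define r where "r = card R"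
  have "finite R" by (simp add: R_def)
  then obtain h where h: "bij_betw h {0..<r} R"
    using ex_bij_betw_nat_finite unfolding r_def by blast
  have hR: "h i < d" "f (h i) < d" if "i < r" for i
    using bij_betwE[OF h] that by (auto simp: R_def)
  have h_eq: "h i = h j \<longleftrightarrow> i = j" if "i < r" "j < r" for i j
    using bij_betw_imp_inj_on[OF h] that by (auto simp: inj_on_def)
  \<comment> \<open>\<open>V\<close> keeps the nonzero rows of \<open>C\<close>, and
    \<open>U\<close> the columns of \<open>S\<close> that meet them in \<open>A = S C\<close>.
    \<open>L\<close> inverts \<open>U\<close> from the left because \<open>T S = 1\<close>;
    \<open>W\<close> picks the pivot columns of \<open>V\<close>, which are unit vectors.\<close>
  define U where "U = mat d r (\<lambda>(i, j). S $$ (i, h j))"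
  define V where "V = mat r d (\<lambda>(i, j). C $$ (h i, j))"
  define L where "L = mat r d (\<lambda>(i, j). T $$ (h i, j))"
  define W where "W = mat d r (\<lambda>(i, j). if i = f (h j) then 1 else 0 :: 'a)"
  have U: "U \<in> carrier_mat d r" and V: "V \<in> carrier_mat r d"
    and L: "L \<in> carrier_mat r d" and W: "W \<in> carrier_mat d r"
    by (auto simp: U_def V_def L_def W_def)
  have zero: "C $$ (i, j) = 0" if "i < d" "i \<notin> R" "j < d" for i j
  proof -
    have "f i = d" using piv(1)[of i] that by (auto simp: R_def)
    then show ?thesis using piv(2)[of i j] that by simp
  qed
  have UV: "U * V = A"
  proof (rule eq_matI)
    fix i j assume ij: "i < dim_row A" "j < dim_col A"
    have "(U * V) $$ (i, j) = (\<Sum>k\<in>{0..<r}. S $$ (i, h k) * C $$ (h k, j))"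
      using ij A by (simp add: U_def V_def scalar_prod_def)
    also have "\<dots> = (\<Sum>k\<in>R. S $$ (i, k) * C $$ (k, j))"
      by (rule sum.reindex_bij_betw[OF h])
    also have "\<dots> = (\<Sum>k\<in>{0..<d}. S $$ (i, k) * C $$ (k, j))"
      using zero ij A by (intro sum.mono_neutral_left) (auto simp: R_def)
    also have "\<dots> = (S * C) $$ (i, j)"
      using ij A S C by (simp add: scalar_prod_def)
    finally show "(U * V) $$ (i, j) = A $$ (i, j)" by (simp add: SC)
  qed (use U V A in auto)
  have LU: "L * U = 1\<^sub>m r"
  proof (rule eq_matI)
    fix i j assume "i < dim_row (1\<^sub>m r)" "j < dim_col (1\<^sub>m r)"
    then have ij: "i < r" "j < r" by auto
    have "(L * U) $$ (i, j) = (T * S) $$ (h i, h j)"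
      using ij T S hR by (simp add: L_def U_def scalar_prod_def)
    then show "(L * U) $$ (i, j) = 1\<^sub>m r $$ (i, j)" using ij hR h_eq by (simp add: TS)
  qed (auto simp: L_def U_def)
  have VW: "V * W = 1\<^sub>m r"
  proof (rule eq_matI)
    fix i j assume "i < dim_row (1\<^sub>m r)" "j < dim_col (1\<^sub>m r)"
    then have ij: "i < r" "j < r" by auto
    have "(V * W) $$ (i, j) = C $$ (h i, f (h j))"
      using ij hR by (simp add: V_def W_def scalar_prod_def if_distrib sum.delta cong: if_cong)
    also have "\<dots> = (if i = j then 1 else 0)"
      using piv(4)[of "h i"] piv(5)[of "h j" "h i"] ij hR h_eq by auto
    finally show "(V * W) $$ (i, j) = 1\<^sub>m r $$ (i, j)" using ij by simp
  qed (auto simp: V_def W_def)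
  have V_eq: "L * A = V"
    using LU UV assoc_mult_mat[OF L U V] V by simp
  have U_eq: "A * W = U"
    using VW UV assoc_mult_mat[OF U V W] U by simp
  have "V * U = L * (A * U)"
    using V_eq assoc_mult_mat[OF L A U] by simp
  \<comment> \<open>Idempotence enters here: \<open>A U = A A W = A W = U\<close>.\<close>
  also have "A * U = U"
    using idem U_eq assoc_mult_mat[OF A A W] by simp
  also have "L * U = 1\<^sub>m r" by (rule LU)
  finally show thesis using that U V UV by blast
qed

section \<open>Characters from multiplicative families of matrices\<close>

lemma mat_trace_mult_comm:
  assumes "A \<in> carrier_mat m n" "B \<in> carrier_mat n m"
  shows "mat_trace (A * B) = mat_trace (B * A)"
proof -
  have "mat_trace (A * B) = (\<Sum>i<m. \<Sum>j<n. A $$ (i, j) * B $$ (j, i))"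
    using assms by (simp add: mat_trace_def scalar_prod_def atLeast0LessThan)
  also have "\<dots> = (\<Sum>j<n. \<Sum>i<m. B $$ (j, i) * A $$ (i, j))"
    by (subst sum.swap) (simp add: mult.commute)
  also have "\<dots> = mat_trace (B * A)"
    using assms by (simp add: mat_trace_def scalar_prod_def atLeast0LessThan)
  finally show ?thesis .
qed

text \<open>\<open>\<rho> (inv g)\<close> is a two-sided inverse of \<open>\<rho> g\<close>, so
  plain matrix equations already force the values into the unit group.\<close>

lemma GL_hom_iff:
  assumes "group G"
  shows "\<rho> \<in> hom G (GL n) \<longleftrightarrow>
    (\<forall>g\<in>carrier G. \<rho> g \<in> carrier_mat n n) \<and> \<rho> \<one>\<^bsub>G\<^esub> = 1\<^sub>m n \<and>
    (\<forall>g\<in>carrier G. \<forall>h\<in>carrier G. \<rho> (g \<otimes>\<^bsub>G\<^esub> h) = \<rho> g * \<rho> h)"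
proof -
  interpret G: group G by fact
  interpret M: monoid "ring_mat TYPE(complex) n ()"
    by (rule ring.is_monoid[OF ring_mat])
  interpret GL: group "GL n" unfolding GL_def by (rule M.units_group)
  show ?thesis
  proof (intro iffI conjI ballI)
    assume h: "\<rho> \<in> hom G (GL n)"
    then interpret group_hom G "GL n" \<rho> by (unfold_locales) simp
    show "\<rho> \<one>\<^bsub>G\<^esub> = 1\<^sub>m n" 
      using hom_one by (simp add: GL_def units_of_def ring_mat_def)
    show "\<rho> g \<in> carrier_mat n n" if "g \<in> carrier G" for g
      using hom_closed[OF that] by (auto simp: GL_def units_of_def Units_def ring_mat_def)
    show "\<rho> (g \<otimes>\<^bsub>G\<^esub> h) = \<rho> g * \<rho> h" if "g \<in> carrier G" "h \<in> carrier G" for g h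
      using hom_mult[OF that] by (simp add: GL_def units_of_def ring_mat_def)
  next
    assume *: "(\<forall>g\<in>carrier G. \<rho> g \<in> carrier_mat n n) \<and> \<rho> \<one>\<^bsub>G\<^esub> = 1\<^sub>m n \<and>
      (\<forall>g\<in>carrier G. \<forall>h\<in>carrier G. \<rho> (g \<otimes>\<^bsub>G\<^esub> h) = \<rho> g * \<rho> h)"
    have "\<rho> g \<in> carrier (GL n)" if g: "g \<in> carrier G" for g
    proof -
      have "\<rho> (inv\<^bsub>G\<^esub> g) * \<rho> g = 1\<^sub>m n" "\<rho> g * \<rho> (inv\<^bsub>G\<^esub> g) = 1\<^sub>m n"
        using * g by (metis G.inv_closed G.l_inv, metis G.inv_closed G.r_inv)
      then show ?thesis using * g
        by (auto simp: GL_def units_of_def Units_def ring_mat_def intro!: bexI[of _ "\<rho> (inv\<^bsub>G\<^esub> g)"])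
    qed
    with * show "\<rho> \<in> hom G (GL n)"
      by (auto simp: hom_def GL_def units_of_def ring_mat_def)
  qed
qed

text \<open>At the identity \<open>E\<close> is an idempotent \<open>U V\<close>. Since
  \<open>E g\<close> absorbs it on the right, \<open>V E(g) U\<close> is a representation of size
  \<open>r\<close>, and cyclicity of the trace gives it the character of \<open>E\<close>.\<close>

lemma idempotent_rep_in_Cha:
  assumes G: "group G"
    and carr: "\<And>g. g \<in> carrier G \<Longrightarrow> E g \<in> carrier_mat d d"
    and mult: "\<And>g h. g \<in> carrier G \<Longrightarrow> h \<in> carrier G \<Longrightarrow> E (g \<otimes>\<^bsub>G\<^esub> h) = E g * E h"
  shows "character_of G E \<in> Cha G"
proof -
  interpret G: group G by fact
  let ?P = "E \<one>\<^bsub>G\<^esub>"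
  have "?P * ?P = ?P" using mult[of "\<one>\<^bsub>G\<^esub>" "\<one>\<^bsub>G\<^esub>"] by simp
  then obtain r U V where U: "U \<in> carrier_mat d r" and V: "V \<in> carrier_mat r d"
    and UV: "U * V = ?P" and VU: "V * U = 1\<^sub>m r"
    by (rule idempotent_mat_split[OF carr[OF G.one_closed]])
  define \<rho> where "\<rho> = (\<lambda>g. V * (E g * U))"
  have "\<rho> (g \<otimes>\<^bsub>G\<^esub> h) = \<rho> g * \<rho> h" if g: "g \<in> carrier G" and h: "h \<in> carrier G" for g h
  proof -
    note g' = carr[OF g] and h' = carr[OF h]
    have gU: "E g * U \<in> carrier_mat d r" and hU: "E h * U \<in> carrier_mat d r"
      using g' h' U by auto
    have "E g * U * V = E g * ?P" using assoc_mult_mat[OF g' U V] UV by simp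
    also have "\<dots> = E g" using mult[OF g G.one_closed] g by simp
    finally have gUV: "E g * U * V = E g" .
    have "\<rho> g * \<rho> h = V * ((E g * U) * (V * (E h * U)))"
      unfolding \<rho>_def by (rule assoc_mult_mat[OF V gU]) (rule mult_carrier_mat[OF V hU])
    also have "(E g * U) * (V * (E h * U)) = E g * (E h * U)"
      using assoc_mult_mat[OF gU V hU] gUV by simp
    also have "\<dots> = E g * E h * U"
      by (rule assoc_mult_mat[OF g' h' U, symmetric])
    finally show ?thesis using g h by (simp add: \<rho>_def mult)
  qed
  moreover have "\<rho> \<one>\<^bsub>G\<^esub> = 1\<^sub>m r"
  proof -
    have "?P * U = U * (V * U)" using assoc_mult_mat[OF U V U] UV by simp
    then show ?thesis using U VU by (simp add: \<rho>_def)
  qed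
  moreover have "\<rho> g \<in> carrier_mat r r" if "g \<in> carrier G" for g
    using carr[OF that] U V by (auto simp: \<rho>_def)
  ultimately have "\<rho> \<in> hom G (GL r)" unfolding GL_hom_iff[OF G] by (simp add: VU)
  moreover have "character_of G \<rho> = character_of G E"
  proof -
    have "mat_trace (\<rho> g) = mat_trace (E g)" if g: "g \<in> carrier G" for g
    proof -
      note g' = carr[OF g]
      have "mat_trace (\<rho> g) = mat_trace (E g * U * V)"
        unfolding \<rho>_def using g' U V by (intro mat_trace_mult_comm) auto
      also have "E g * U * V = E g * E \<one>\<^bsub>G\<^esub>" using assoc_mult_mat[OF g' U V] UV by simp
      also have "\<dots> = E g" using mult[OF g G.one_closed] g by simp
      finally show ?thesis .
    qed
    then show ?thesis by (auto simp: character_of_def)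
  qed
  ultimately show ?thesis unfolding Cha_def mem_Collect_eq by metis
qed

text \<open>Admits any finite index set \<open>X\<close>, such as the tuples indexing a basis of a
  tensor power; an enumeration \<open>b\<close> of \<open>X\<close> leads back to matrices.\<close>

lemma kernel_rep_in_Cha:
  assumes G: "group G" and X: "finite X"
    and mult: "\<And>g h x z. g \<in> carrier G \<Longrightarrow> h \<in> carrier G \<Longrightarrow> x \<in> X \<Longrightarrow> z \<in> X \<Longrightarrow>
      K (g \<otimes>\<^bsub>G\<^esub> h) x z = (\<Sum>y\<in>X. K g x y * K h y z)"
  shows "(\<lambda>g. if g \<in> carrier G then \<Sum>x\<in>X. K g x x else 0) \<in> Cha G"
proof -
  from X obtain b where b: "bij_betw b {0..<card X} X"
    using ex_bij_betw_nat_finite by blast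
  have bX: "b i \<in> X" if "i < card X" for i using bij_betwE[OF b] that by auto
  define E where "E = (\<lambda>g. mat (card X) (card X) (\<lambda>(i, j). K g (b i) (b j)))"
  have "character_of G E \<in> Cha G"
  proof (rule idempotent_rep_in_Cha[OF G])
    show "E g \<in> carrier_mat (card X) (card X)" for g by (simp add: E_def)
    fix g h assume gh: "g \<in> carrier G" "h \<in> carrier G"
    show "E (g \<otimes>\<^bsub>G\<^esub> h) = E g * E h"
    proof (rule eq_matI)
      fix i j assume "i < dim_row (E g * E h)" "j < dim_col (E g * E h)"
      then have ij: "i < card X" "j < card X" by (auto simp: E_def)
      show "E (g \<otimes>\<^bsub>G\<^esub> h) $$ (i, j) = (E g * E h) $$ (i, j)"
        using ij bX gh sum.reindex_bij_betw[OF b, of "\<lambda>y. K g (b i) y * K h y (b j)"]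
        by (simp add: E_def scalar_prod_def mult)
    qed (auto simp: E_def)
  qed
  also have "character_of G E = (\<lambda>g. if g \<in> carrier G then \<Sum>x\<in>X. K g x x else 0)"
    using sum.reindex_bij_betw[OF b, of "\<lambda>x. K g x x" for g]
    by (auto simp: character_of_def mat_trace_def E_def simp flip: atLeast0LessThan)
  finally show ?thesis .
qed

section \<open>Newton's recursion\<close>

text \<open>
  With the power sums \<open>p\<close> of the eigenvalues, \<open>e = -1\<close> gives the elementary and \<open>e = 1\<close> the complete
  homogeneous symmetric functions. The value \<open>p 0\<close> is irrelevant.
\<close>

function newton :: "complex \<Rightarrow> (nat \<Rightarrow> complex) \<Rightarrow> nat \<Rightarrow> complex" where
  "newton e p 0 = 1"
| "newton e p (Suc k) = (\<Sum>j\<le>k. e ^ j * p (Suc j) * newton e p (k - j)) / of_nat (Suc k)"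
  by pat_completeness auto
termination by (relation "measure (\<lambda>(e, p, k). k)") auto

declare newton.simps(2) [simp del]

text \<open>Each value determines the next because \<open>Suc k\<close> is invertible in the complex
  numbers. Serves to recognise the coefficients of both power series.\<close>

lemma newton_unique:
  assumes "c 0 = 1"
    and "\<And>k. of_nat (Suc k) * c (Suc k) = (\<Sum>j\<le>k. e ^ j * p (Suc j) * c (k - j))"
  shows "c n = newton e p n"
proof (induction n rule: less_induct)
  case (less n)
  show ?case
  proof (cases n)
    case (Suc k)
    have "of_nat (Suc k) * c (Suc k) = (\<Sum>j\<le>k. e ^ j * p (Suc j) * newton e p (k - j))"
      unfolding assms(2) using less Suc by (intro sum.cong) auto
    then show ?thesis unfolding Suc newton.simps(2) by (simp add: field_simps del: of_nat_Suc)
  qed (simp add: assms(1))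
qed

lemma newton_cong:
  assumes "\<And>j. j > 0 \<Longrightarrow> p j = q j"
  shows "newton e p n = newton e q n"
proof (rule newton_unique)
  fix k
  show "of_nat (Suc k) * newton e p (Suc k) = (\<Sum>j\<le>k. e ^ j * q (Suc j) * newton e p (k - j))"
    by (simp add: newton.simps(2) assms del: of_nat_Suc)
qed simp

section \<open>The (anti)symmetrizer on tensor powers\<close>

text \<open>The trivial character of the symmetric group for \<open>e = 1\<close> and the sign for
  \<open>e = -1\<close>; one parameter treats symmetric and exterior powers together.\<close>

definition twist :: "complex \<Rightarrow> ('i \<Rightarrow> 'i) \<Rightarrow> complex" where
  "twist e \<sigma> = (if evenperm \<sigma> then 1 else e)"

lemma twist_id [simp]: "twist e id = 1"
  by (simp add: twist_def)

lemma twist_compose: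
  assumes "e * e = 1" "permutation p" "permutation q"
  shows "twist e (p \<circ> q) = twist e p * twist e q"
  using assms by (auto simp: twist_def evenperm_comp)

lemma twist_transpose_compose:
  assumes "e * e = 1" "permutation p" "a \<noteq> b"
  shows "twist e (transpose a b \<circ> p) = e * twist e p"
  using assms by (simp add: twist_compose permutation_swap_id)
    (simp add: twist_def evenperm_swap)

text \<open>Matrices are kernels, functions of two indices from \<open>I\<close>; the same format
  covers tensor powers, whose indices are tuples in
  \<open>S \<rightarrow>\<^sub>E I\<close>.\<close>

definition kcomp :: "'v set \<Rightarrow> ('v \<Rightarrow> 'v \<Rightarrow> complex) \<Rightarrow> ('v \<Rightarrow> 'v \<Rightarrow> complex) \<Rightarrow> 'v \<Rightarrow> 'v \<Rightarrow> complex" where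
  "kcomp I A B v w = (\<Sum>u\<in>I. A v u * B u w)"

definition ktrace :: "'v set \<Rightarrow> ('v \<Rightarrow> 'v \<Rightarrow> complex) \<Rightarrow> complex" where
  "ktrace I A = (\<Sum>v\<in>I. A v v)"

text \<open>Entry of the tensor power of \<open>A\<close> over the positions \<open>S\<close>,
  composed with the symmetrizer (\<open>e = 1\<close>) or antisymmetrizer (\<open>e = -1\<close>);
  \<open>s\<close> and \<open>t\<close> index the tensor basis.\<close>

definition twisted_power ::
    "complex \<Rightarrow> 'i set \<Rightarrow> ('v \<Rightarrow> 'v \<Rightarrow> complex) \<Rightarrow> ('i \<Rightarrow> 'v) \<Rightarrow> ('i \<Rightarrow> 'v) \<Rightarrow> complex" where
  "twisted_power e S A s t =
     (\<Sum>\<sigma> | \<sigma> permutes S. twist e \<sigma> * (\<Prod>i\<in>S. A (s i) (t (\<sigma> i)))) / fact (card S)"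

text \<open>Tensor powers commute with permuting positions, and the (anti)symmetrizer is idempotent.
  In coordinates, the pair \<open>\<sigma>\<close>, \<open>\<tau>\<close> contributes a term
  depending on \<open>\<tau> \<circ> \<sigma>\<close> alone; each permutation arises
  \<open>fact (card S)\<close> times, which cancels one of two factorials.\<close>

lemma twisted_power_kcomp:
  fixes S :: "'i set"
  assumes e: "e * e = 1" and S: "finite S" and I: "finite I"
  shows "(\<Sum>u\<in>S \<rightarrow>\<^sub>E I. twisted_power e S A s u * twisted_power e S B u t) =
    twisted_power e S (kcomp I A B) s t"
proof -
  let ?P = "{\<sigma>. \<sigma> permutes S}"
  let ?h = "\<lambda>\<pi>. twist e \<pi> * (\<Prod>i\<in>S. kcomp I A B (s i) (t (\<pi> i)))"
  have perm: "permutation \<sigma>" if "\<sigma> \<in> ?P" for \<sigma>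
    using that S by (auto simp: permutation_permutes)
  have "(\<Sum>u\<in>S \<rightarrow>\<^sub>E I. twist e \<sigma> * (\<Prod>i\<in>S. A (s i) (u (\<sigma> i))) *
      (twist e \<tau> * (\<Prod>i\<in>S. B (u i) (t (\<tau> i))))) = ?h (\<tau> \<circ> \<sigma>)"
    if \<sigma>: "\<sigma> \<in> ?P" and \<tau>: "\<tau> \<in> ?P" for \<sigma> \<tau>
  proof -
    \<comment> \<open>Moving \<open>\<sigma>\<close> from \<open>u\<close> to \<open>s\<close> lets
      the summand factor position by position in \<open>u\<close>, so that the sum over
      \<open>u\<close> becomes a product of sums.\<close>
    have "(\<Prod>i\<in>S. A (s i) (u (\<sigma> i))) = (\<Prod>i\<in>S. A (s (inv_into UNIV \<sigma> i)) (u i))" for u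
      using \<sigma> permutes_inverses[of \<sigma> S]
        prod.permute[of \<sigma> S "\<lambda>i. A (s (inv_into UNIV \<sigma> i)) (u i)"]
      by (simp add: o_def)
    then have "(\<Sum>u\<in>S \<rightarrow>\<^sub>E I. (\<Prod>i\<in>S. A (s i) (u (\<sigma> i))) * (\<Prod>i\<in>S. B (u i) (t (\<tau> i)))) =
        (\<Sum>u\<in>S \<rightarrow>\<^sub>E I. \<Prod>i\<in>S. A (s (inv_into UNIV \<sigma> i)) (u i) * B (u i) (t (\<tau> i)))"
      by (simp add: prod.distrib)
    also have "\<dots> = (\<Prod>i\<in>S. kcomp I A B (s (inv_into UNIV \<sigma> i)) (t (\<tau> i)))"
      unfolding kcomp_def using S I by (subst prod_sum_PiE) auto
    also have "\<dots> = (\<Prod>i\<in>S. kcomp I A B (s i) (t (\<tau> (\<sigma> i))))"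
      using \<sigma> permutes_inverses[of \<sigma> S]
        prod.permute[of \<sigma> S "\<lambda>i. kcomp I A B (s (inv_into UNIV \<sigma> i)) (t (\<tau> i))"]
      by (simp add: o_def)
    finally show ?thesis
      using perm[OF \<sigma>] perm[OF \<tau>] e
      by (simp add: twist_compose mult_ac flip: sum_distrib_left)
  qed
  then have "(\<Sum>\<sigma>\<in>?P. \<Sum>\<tau>\<in>?P. \<Sum>u\<in>S \<rightarrow>\<^sub>E I. twist e \<sigma> * (\<Prod>i\<in>S. A (s i) (u (\<sigma> i))) *
      (twist e \<tau> * (\<Prod>i\<in>S. B (u i) (t (\<tau> i))))) = (\<Sum>\<sigma>\<in>?P. \<Sum>\<tau>\<in>?P. ?h (\<tau> \<circ> \<sigma>))"
    by (intro sum.cong) auto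
  \<comment> \<open>For fixed \<open>\<sigma>\<close>, sending \<open>\<tau>\<close> to
    \<open>\<tau> \<circ> \<sigma>\<close> is a bijection on the permutations of
    \<open>S\<close>.\<close>
  also have "\<dots> = (\<Sum>\<sigma>\<in>?P. \<Sum>\<pi>\<in>?P. ?h \<pi>)"
    by (intro sum.cong refl sum_permutations_compose_right[symmetric]) auto
  also have "\<dots> = fact (card S) * (\<Sum>\<pi>\<in>?P. ?h \<pi>)"
    using S by (simp add: card_permutations)
  finally have *: "(\<Sum>\<sigma>\<in>?P. \<Sum>\<tau>\<in>?P. \<Sum>u\<in>S \<rightarrow>\<^sub>E I. twist e \<sigma> * (\<Prod>i\<in>S. A (s i) (u (\<sigma> i))) *
      (twist e \<tau> * (\<Prod>i\<in>S. B (u i) (t (\<tau> i))))) = fact (card S) * (\<Sum>\<pi>\<in>?P. ?h \<pi>)" .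
  have "(\<Sum>u\<in>S \<rightarrow>\<^sub>E I. twisted_power e S A s u * twisted_power e S B u t) =
      (\<Sum>u\<in>S \<rightarrow>\<^sub>E I. \<Sum>\<sigma>\<in>?P. \<Sum>\<tau>\<in>?P. twist e \<sigma> * (\<Prod>i\<in>S. A (s i) (u (\<sigma> i))) *
      (twist e \<tau> * (\<Prod>i\<in>S. B (u i) (t (\<tau> i))))) / (fact (card S) * fact (card S))"
    by (simp add: twisted_power_def sum_product flip: sum_divide_distrib)
  also have "\<dots> = (\<Sum>\<sigma>\<in>?P. \<Sum>\<tau>\<in>?P. \<Sum>u\<in>S \<rightarrow>\<^sub>E I. twist e \<sigma> * (\<Prod>i\<in>S. A (s i) (u (\<sigma> i))) *
      (twist e \<tau> * (\<Prod>i\<in>S. B (u i) (t (\<tau> i))))) / (fact (card S) * fact (card S))"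
    by (subst sum.swap, subst (2) sum.swap) (rule refl)
  also have "\<dots> = twisted_power e S (kcomp I A B) s t"
    unfolding * by (simp add: twisted_power_def)
  finally show ?thesis .
qed

section \<open>Traces by contraction of cycles\<close>

text \<open>
  Up to the factor \<open>1 / k!\<close>, \<open>cycle_sum\<close> is the trace of \<open>twisted_power\<close>. In \<open>marked_cycle_sum\<close> the
  factor at the position \<open>a\<close> is an arbitrary \<open>B\<close>, since contracting \<open>a\<close> out of its cycle replaces the
  factor of the preceding position by the product \<open>A B\<close>.
\<close>

definition cycle_sum :: "complex \<Rightarrow> 'v set \<Rightarrow> ('v \<Rightarrow> 'v \<Rightarrow> complex) \<Rightarrow> 'i set \<Rightarrow> complex" where
  "cycle_sum e I A S =
     (\<Sum>\<sigma> | \<sigma> permutes S. twist e \<sigma> * (\<Sum>s\<in>S \<rightarrow>\<^sub>E I. \<Prod>i\<in>S. A (s i) (s (\<sigma> i))))"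

definition marked_cycle_sum :: "complex \<Rightarrow> 'v set \<Rightarrow> ('v \<Rightarrow> 'v \<Rightarrow> complex) \<Rightarrow>
    'i \<Rightarrow> 'i set \<Rightarrow> ('v \<Rightarrow> 'v \<Rightarrow> complex) \<Rightarrow> complex" where
  "marked_cycle_sum e I A a S B =
     (\<Sum>\<sigma> | \<sigma> permutes insert a S. twist e \<sigma> *
        (\<Sum>s\<in>insert a S \<rightarrow>\<^sub>E I. B (s a) (s (\<sigma> a)) * (\<Prod>i\<in>S. A (s i) (s (\<sigma> i)))))"

lemma cycle_sum_insert:
  assumes "finite S" "a \<notin> S"
  shows "cycle_sum e I A (insert a S) = marked_cycle_sum e I A a S A"
  using assms by (simp add: cycle_sum_def marked_cycle_sum_def)

lemma sum_PiE_insert: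
  assumes "a \<notin> S"
  shows "sum f (insert a S \<rightarrow>\<^sub>E I) = (\<Sum>s\<in>S \<rightarrow>\<^sub>E I. \<Sum>v\<in>I. f (s(a := v)))"
proof -
  have inj: "inj_on (\<lambda>(v, s). s(a := v)) (I \<times> (S \<rightarrow>\<^sub>E I))"
    using inj_combinator[OF assms, of "\<lambda>_. I"] by simp
  show ?thesis
    unfolding PiE_insert_eq sum.reindex[OF inj]
    by (subst sum.swap) (simp add: sum.cartesian_product case_prod_unfold)
qed

text \<open>Permutations of \<open>insert a S\<close> are uniquely
  \<open>transpose a b \<circ> p\<close> with \<open>p\<close> permuting \<open>S\<close>. For
  \<open>b = a\<close> the point \<open>a\<close> is fixed and splits off the trace of
  \<open>B\<close>. For \<open>b = p c\<close> it sits between \<open>c\<close> and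
  \<open>p c\<close>; summing over its index merges \<open>A\<close> at \<open>c\<close> with
  \<open>B\<close>, and the transposition costs a factor \<open>e\<close>.\<close>

lemma marked_cycle_sum_rec:
  assumes e: "e * e = 1" and S: "finite S" and a: "a \<notin> S"
  shows "marked_cycle_sum e I A a S B =
    ktrace I B * cycle_sum e I A S +
    e * (\<Sum>b\<in>S. marked_cycle_sum e I A b (S - {b}) (kcomp I A B))"
proof -
  let ?P = "{\<sigma>. \<sigma> permutes S}"
  define g where "g \<sigma> = twist e \<sigma> *
    (\<Sum>s\<in>insert a S \<rightarrow>\<^sub>E I. B (s a) (s (\<sigma> a)) * (\<Prod>i\<in>S. A (s i) (s (\<sigma> i))))" for \<sigma>
  \<comment> \<open>The summand after contraction: the mark has moved from \<open>a\<close> to its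
    predecessor \<open>b\<close>.\<close>
  define m where "m b p = twist e p * (\<Sum>s\<in>S \<rightarrow>\<^sub>E I. kcomp I A B (s b) (s (p b)) *
    (\<Prod>i\<in>S - {b}. A (s i) (s (p i))))" for b p
  have upd: "(s(a := v)) i = s i" if "i \<in> S" for s :: "'a \<Rightarrow> 'b" and v i
    using that a by auto
  have fixed: "g p = ktrace I B * (twist e p * (\<Sum>s\<in>S \<rightarrow>\<^sub>E I. \<Prod>i\<in>S. A (s i) (s (p i))))"
    if p: "p \<in> ?P" for p
  proof -
    have pS: "p i \<in> S" if "i \<in> S" for i
      using p that by (auto simp: permutes_in_image)
    have "p a = a" using p a by (auto simp: permutes_not_in)
    then have "g p = twist e p * (\<Sum>s\<in>S \<rightarrow>\<^sub>E I. \<Sum>v\<in>I. B v v * (\<Prod>i\<in>S. A (s i) (s (p i))))"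
      using pS upd a unfolding g_def sum_PiE_insert[OF a]
      by (intro arg_cong2[where f = "(*)"] refl sum.cong prod.cong) auto
    then show ?thesis by (simp add: ktrace_def sum_distrib_left sum_distrib_right mult_ac)
  qed
  have moved: "g (transpose a (p c) \<circ> p) = e * m c p"
    if p: "p \<in> ?P" and c: "c \<in> S" for p c
  proof -
    have pa: "p a = a" using p a by (auto simp: permutes_not_in)
    have pS: "p i \<in> S" if "i \<in> S" for i using p that by (auto simp: permutes_in_image)
    have ne: "p i \<noteq> p c" if "i \<noteq> c" for i
      using p that by (metis mem_Collect_eq permutes_inj inj_eq)
    have pca: "a \<noteq> p c" using pS[OF c] a by auto
    let ?t = "transpose a (p c) \<circ> p"
    have t: "?t a = p c" "?t c = a" "\<And>i. i \<in> S - {c} \<Longrightarrow> ?t i = p i"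
      using pa ne pS a by (auto simp: transpose_def)
    have "twist e ?t = e * twist e p"
      using p S pca e by (intro twist_transpose_compose) (auto simp: permutation_permutes)
    moreover have "(\<Sum>s\<in>insert a S \<rightarrow>\<^sub>E I. B (s a) (s (?t a)) * (\<Prod>i\<in>S. A (s i) (s (?t i)))) =
      (\<Sum>s\<in>S \<rightarrow>\<^sub>E I. kcomp I A B (s c) (s (p c)) * (\<Prod>i\<in>S - {c}. A (s i) (s (p i))))"
    proof -
      have "(\<Sum>v\<in>I. B ((s(a := v)) a) ((s(a := v)) (?t a)) *
          (\<Prod>i\<in>S. A ((s(a := v)) i) ((s(a := v)) (?t i)))) =
        kcomp I A B (s c) (s (p c)) * (\<Prod>i\<in>S - {c}. A (s i) (s (p i)))" for s
      proof -
        have "(\<Prod>i\<in>S. A ((s(a := v)) i) ((s(a := v)) (?t i))) =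
            A (s c) v * (\<Prod>i\<in>S - {c}. A (s i) (s (p i)))" for v
        proof -
          have "(\<Prod>i\<in>S - {c}. A ((s(a := v)) i) ((s(a := v)) (?t i))) =
              (\<Prod>i\<in>S - {c}. A (s i) (s (p i)))"
            using t(3) upd pS by (intro prod.cong) (auto simp del: fun_upd_apply o_apply)
          then show ?thesis
            using t(2) upd[OF c] by (simp add: prod.remove[OF S c] del: o_apply)
        qed
        then show ?thesis
          using t(1) upd[OF pS[OF c]]
          by (simp add: kcomp_def sum_distrib_right mult_ac del: o_apply fun_upd_apply)
            (simp add: mult_ac)
      qed
      then show ?thesis unfolding sum_PiE_insert[OF a] by simp
    qed
    ultimately show ?thesis by (simp add: g_def m_def)
  qed
  have m_eq: "marked_cycle_sum e I A b (S - {b}) (kcomp I A B) = (\<Sum>p\<in>?P. m b p)" if "b \<in> S" for b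
    using that by (simp add: marked_cycle_sum_def m_def insert_absorb)
  have "marked_cycle_sum e I A a S B = (\<Sum>b\<in>insert a S. \<Sum>p\<in>?P. g (transpose a b \<circ> p))"
    unfolding marked_cycle_sum_def g_def by (rule sum_over_permutations_insert[OF S a])
  also have "\<dots> = (\<Sum>p\<in>?P. g p) + (\<Sum>p\<in>?P. \<Sum>b\<in>S. g (transpose a b \<circ> p))"
    using S a by (simp add: sum.swap[of _ S])
  also have "(\<Sum>p\<in>?P. g p) = ktrace I B * cycle_sum e I A S"
    by (simp add: fixed cycle_sum_def sum_distrib_left)
  also have "(\<Sum>p\<in>?P. \<Sum>b\<in>S. g (transpose a b \<circ> p)) = (\<Sum>p\<in>?P. \<Sum>c\<in>S. e * m c p)"
  proof (rule sum.cong[OF refl])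
    fix p assume p: "p \<in> ?P"
    \<comment> \<open>Reindexes by the predecessor \<open>c\<close> of \<open>b\<close> under
      \<open>p\<close>, the position that receives the mark.\<close>
    have "(\<Sum>b\<in>S. g (transpose a b \<circ> p)) = (\<Sum>c\<in>S. g (transpose a (p c) \<circ> p))"
      using p by (intro sum.reindex_bij_betw[symmetric]) (simp add: permutes_imp_bij)
    then show "(\<Sum>b\<in>S. g (transpose a b \<circ> p)) = (\<Sum>c\<in>S. e * m c p)"
      using moved[OF p] by simp
  qed
  also have "\<dots> = e * (\<Sum>b\<in>S. \<Sum>p\<in>?P. m b p)"
    by (subst sum.swap) (simp add: sum_distrib_left)
  finally show ?thesis by (simp add: m_eq)
qed

text \<open>The product \<open>A^j B\<close>, built up in the last argument to match the passage
  from \<open>B\<close> to \<open>kcomp I A B\<close> in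
  \<open>marked_cycle_sum_rec\<close>.\<close>

fun kpow :: "'v set \<Rightarrow> ('v \<Rightarrow> 'v \<Rightarrow> complex) \<Rightarrow> nat \<Rightarrow> ('v \<Rightarrow> 'v \<Rightarrow> complex) \<Rightarrow> 'v \<Rightarrow> 'v \<Rightarrow> complex" where
  "kpow I A 0 B = B"
| "kpow I A (Suc j) B = kpow I A j (kcomp I A B)"

text \<open>Contraction changes \<open>B\<close>, so the induction carries a statement on marked
  sums for every \<open>B\<close>; its case \<open>B = A\<close> is Newton's recursion one size up.
  For \<open>j > 0\<close> the kernel \<open>kpow I A (j - 1) A\<close> is \<open>A^j\<close>; the
  truncated difference at \<open>j = 0\<close> is never read by \<open>newton\<close>.\<close>

lemma cycle_sum_newton:
  fixes S :: "'i set"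
  assumes e: "e * e = 1" and S: "finite S"
  shows "cycle_sum e I A S = fact (card S) * newton e (\<lambda>j. ktrace I (kpow I A (j - 1) A)) (card S)"
proof -
  let ?c = "newton e (\<lambda>j. ktrace I (kpow I A (j - 1) A))"
  have "(\<forall>S :: 'i set. finite S \<longrightarrow> card S = k \<longrightarrow> cycle_sum e I A S = fact k * ?c k) \<and>
    (\<forall>S a B. finite S \<longrightarrow> card S = k \<longrightarrow> a \<notin> (S :: 'i set) \<longrightarrow> marked_cycle_sum e I A a S B =
      fact k * (\<Sum>j\<le>k. e ^ j * ktrace I (kpow I A j B) * ?c (k - j)))" for k
  proof (induction k)
    case 0
    have "{\<sigma>. \<sigma> permutes {}} = {id :: 'i \<Rightarrow> 'i}" by auto
    then have c: "cycle_sum e I A ({} :: 'i set) = 1" by (simp add: cycle_sum_def)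
    have "marked_cycle_sum e I A a {} B = ktrace I B" for a :: 'i and B
      using marked_cycle_sum_rec[OF e, of "{}" a I A B] c by simp
    then show ?case using c by simp
  next
    case (Suc k)
    note IH = conjunct1[OF Suc, rule_format] conjunct2[OF Suc, rule_format]
    \<comment> \<open>Mark any point of \<open>S\<close> with \<open>B = A\<close>; \<open>k\<close>
      unmarked points remain.\<close>
    have c: "cycle_sum e I A S = fact (Suc k) * ?c (Suc k)"
      if S: "finite S" "card S = Suc k" for S :: "'i set"
    proof -
      obtain a T where T: "S = insert a T" "a \<notin> T" "card T = k"
        using card_eq_SucD[OF S(2)] by blast
      moreover have "finite T" using S(1) T(1) by simp
      ultimately have "cycle_sum e I A S = fact k * (\<Sum>j\<le>k. e ^ j * ktrace I (kpow I A j A) * ?c (k - j))"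
        by (simp add: cycle_sum_insert IH)
      then show ?thesis by (simp add: newton.simps(2) field_simps del: of_nat_Suc)
    qed
    have "marked_cycle_sum e I A a S B =
      fact (Suc k) * (\<Sum>j\<le>Suc k. e ^ j * ktrace I (kpow I A j B) * ?c (Suc k - j))"
      if "finite S" "card S = Suc k" "a \<notin> S" for S :: "'i set" and a B
    proof -
      have "marked_cycle_sum e I A b (S - {b}) (kcomp I A B) =
          fact k * (\<Sum>j\<le>k. e ^ j * ktrace I (kpow I A (Suc j) B) * ?c (k - j))" if "b \<in> S" for b
        using IH(2)[of "S - {b}" b] that \<open>finite S\<close> \<open>card S = Suc k\<close> by simp
      \<comment> \<open>All \<open>Suc k\<close> choices of \<open>b\<close> contribute equally,
        which turns \<open>fact k\<close> into \<open>fact (Suc k)\<close>.\<close>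
      then have "(\<Sum>b\<in>S. marked_cycle_sum e I A b (S - {b}) (kcomp I A B)) = of_nat (Suc k) *
          (fact k * (\<Sum>j\<le>k. e ^ j * ktrace I (kpow I A (Suc j) B) * ?c (k - j)))"
        using \<open>card S = Suc k\<close> by simp
      then have "marked_cycle_sum e I A a S B = ktrace I B * (fact (Suc k) * ?c (Suc k)) +
          e * (of_nat (Suc k) * (fact k *
            (\<Sum>j\<le>k. e ^ j * ktrace I (kpow I A (Suc j) B) * ?c (k - j))))"
        by (simp only: marked_cycle_sum_rec[OF e that(1,3)] c[OF that(1,2)])
      also have "\<dots> = fact (Suc k) * (ktrace I B * ?c (Suc k) +
          e * (\<Sum>j\<le>k. e ^ j * ktrace I (kpow I A (Suc j) B) * ?c (k - j)))"
        by (simp add: algebra_simps)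
      \<comment> \<open>The fixed-point term becomes the summand \<open>j = 0\<close>, and the
        factor \<open>e\<close> shifts the others up by one.\<close>
      also have "ktrace I B * ?c (Suc k) +
          e * (\<Sum>j\<le>k. e ^ j * ktrace I (kpow I A (Suc j) B) * ?c (k - j)) =
          (\<Sum>j\<le>Suc k. e ^ j * ktrace I (kpow I A j B) * ?c (Suc k - j))"
        by (subst sum.atMost_Suc_shift) (simp add: sum_distrib_left mult_ac)
      finally show ?thesis .
    qed
    with c show ?case by blast
  qed
  then show ?thesis using S by blast
qed

lemma twisted_power_trace:
  assumes "e * e = 1" "finite S"
  shows "(\<Sum>s\<in>S \<rightarrow>\<^sub>E I. twisted_power e S A s s) =
    newton e (\<lambda>j. ktrace I (kpow I A (j - 1) A)) (card S)"
proof -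
  have "(\<Sum>s\<in>S \<rightarrow>\<^sub>E I. twisted_power e S A s s) = cycle_sum e I A S / fact (card S)"
    unfolding twisted_power_def cycle_sum_def
    by (subst sum_divide_distrib[symmetric], subst sum.swap) (simp add: sum_distrib_left)
  then show ?thesis by (simp add: cycle_sum_newton[OF assms])
qed

section \<open>The operations evaluated at a group element\<close>

lemma minus_one_power_fun: "((- 1) ^ m :: 'a \<Rightarrow> complex) x = (- 1) ^ m"
  by (induction m) auto

text \<open>Newton's recursion is coefficient \<open>Suc k\<close> of
  \<open>?P * ?L = - fps_X * fps_deriv ?L\<close>, evaluated at \<open>x\<close>.\<close>

lemma lambda_op_newton:
  assumes "group G" and x: "x \<in> carrier G"
  shows "lambda_op G n f x = newton (- 1) (\<lambda>j. f (x [^]\<^bsub>G\<^esub> j)) n"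
proof (rule newton_unique)
  let ?L = "lambda_series G f" and ?P = "adams_series G f"
  have L: "fps_nth ?L 0 = unit_map G" "?P * ?L = - fps_X * fps_deriv ?L"
    using lambda_series[of G f] by (auto simp: is_lambda_series_iff)
  show "lambda_op G 0 f x = 1"
    using x by (simp add: lambda_op_def L unit_map_def)
  fix k
  have "- of_nat (Suc k) * lambda_op G (Suc k) f x = fps_nth (- fps_X * fps_deriv ?L) (Suc k) x"
    by (simp add: lambda_op_def of_nat_fun algebra_simps del: of_nat_Suc)
  also have "\<dots> = (\<Sum>i=0..Suc k. fps_nth ?P i x * lambda_op G (Suc k - i) f x)"
    unfolding L(2)[symmetric]
    by (simp add: fps_mult_nth sum_pointwise lambda_op_def del: sum.atLeast0_atMost_Suc)
  \<comment> \<open>The Adams series starts in degree 1, so the summand \<open>i = 0\<close>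
    vanishes.\<close>
  also have "\<dots> = (\<Sum>i=0..k. fps_nth ?P (Suc i) x * lambda_op G (k - i) f x)"
    by (subst sum.atLeast0_atMost_Suc_shift) (simp add: adams_series_def)
  also have "\<dots> = - (\<Sum>j\<le>k. (- 1) ^ j * f (x [^]\<^bsub>G\<^esub> Suc j) * lambda_op G (k - j) f x)"
    unfolding sum_negf[symmetric] atLeast0AtMost
  proof (intro sum.cong refl)
    fix i
    show "fps_nth ?P (Suc i) x * lambda_op G (k - i) f x =
        - ((- 1) ^ i * f (x [^]\<^bsub>G\<^esub> Suc i) * lambda_op G (k - i) f x)"
      using x by (simp add: adams_series_def adams_def minus_one_power_fun)
  qed
  finally show "of_nat (Suc k) * lambda_op G (Suc k) f x =
      (\<Sum>j\<le>k. (- 1) ^ j * f (x [^]\<^bsub>G\<^esub> Suc j) * lambda_op G (k - j) f x)"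
    by (simp only: mult_minus_left neg_equal_iff_equal)
qed

lemma sym_series:
  "sym_series G f \<in> Maps_fps G"
  "(lambda_series G f oo - fps_X) * sym_series G f = fps_const (unit_map G)"
proof -
  let ?K = "lambda_series G f oo (- fps_X)"
  have L: "lambda_series G f \<in> Maps_fps G" "fps_nth (lambda_series G f) 0 = unit_map G"
    using lambda_series[of G f] by (auto simp: is_lambda_series_def)
  then have "?K \<in> Maps_fps G" by (auto simp: Maps_fps_def Maps_def fps_compose_uminus')
  moreover have "fps_nth ?K 0 = unit_map G" using L(2) by simp
  ultimately show "sym_series G f \<in> Maps_fps G" "?K * sym_series G f = fps_const (unit_map G)"
    unfolding sym_series_def by (rule series_inverse)+
qed

text \<open>At \<open>x\<close> everything reduces to scalar series: Newton's recursion for the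
  lambda operations reads \<open>k' = - q k\<close>, and differentiating \<open>k s = 1\<close>
  turns it into \<open>s' = q s\<close>, the recursion with \<open>e = 1\<close>.\<close>

lemma sym_op_newton:
  assumes "group G" and x: "x \<in> carrier G"
  shows "sym_op G n f x = newton 1 (\<lambda>j. f (x [^]\<^bsub>G\<^esub> j)) n"
proof -
  let ?K = "lambda_series G f oo (- fps_X)" and ?p = "\<lambda>j. f (x [^]\<^bsub>G\<^esub> j)"
  \<comment> \<open>\<open>k\<close> is the lambda series at \<open>-t\<close> and \<open>s\<close>
    the symmetric series, both evaluated at \<open>x\<close>; \<open>q\<close> holds the power sums
    shifted down by one degree.\<close>
  define k where "k = Abs_fps (\<lambda>n. (- 1) ^ n * lambda_op G n f x)"
  define s where "s = Abs_fps (\<lambda>n. sym_op G n f x)"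
  define q where "q = Abs_fps (\<lambda>j. ?p (Suc j))"
  have K: "fps_nth ?K n y = (- 1) ^ n * lambda_op G n f y" for n y
    by (simp add: fps_compose_uminus' lambda_op_def minus_one_power_fun)
  have KS: "fps_nth (?K * sym_series G f) n x = fps_nth (fps_const (unit_map G)) n x" for n
    by (simp only: sym_series)
  have ks: "k * s = 1"
  proof (rule fps_ext)
    fix n show "fps_nth (k * s) n = fps_nth 1 n"
      using KS[of n] x K
      by (simp add: fps_mult_nth sum_pointwise k_def s_def sym_op_def unit_map_def
        split: if_splits)
  qed
  have dk: "fps_deriv k = - (q * k)"
  proof (rule fps_ext)
    fix m
    have "fps_nth (fps_deriv k) m = (- 1) ^ Suc m * (of_nat (Suc m) * lambda_op G (Suc m) f x)"
      by (simp add: k_def algebra_simps)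
    also have "of_nat (Suc m) * lambda_op G (Suc m) f x =
        (\<Sum>j\<le>m. (- 1) ^ j * ?p (Suc j) * lambda_op G (m - j) f x)"
      unfolding lambda_op_newton[OF assms] by (simp add: newton.simps(2) del: of_nat_Suc)
    also have "(- 1) ^ Suc m * \<dots> = (\<Sum>j\<le>m. - (?p (Suc j) * ((- 1) ^ (m - j) * lambda_op G (m - j) f x)))"
      unfolding sum_distrib_left
    proof (intro sum.cong refl)
      fix j assume "j \<in> {..m}"
      then have "(- 1 :: complex) ^ Suc m * (- 1) ^ j = - ((- 1) ^ (m - j))"
        by (simp add: uminus_power_if)
      moreover have "(- 1) ^ Suc m * ((- 1) ^ j * ?p (Suc j) * lambda_op G (m - j) f x) =
          ((- 1) ^ Suc m * (- 1) ^ j) * (?p (Suc j) * lambda_op G (m - j) f x)"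
        by (simp only: mult.assoc)
      ultimately show "(- 1) ^ Suc m * ((- 1) ^ j * ?p (Suc j) * lambda_op G (m - j) f x) =
          - (?p (Suc j) * ((- 1) ^ (m - j) * lambda_op G (m - j) f x))"
        by (simp only: mult_minus_left mult_minus_right mult.left_commute)
    qed
    finally show "fps_nth (fps_deriv k) m = fps_nth (- (q * k)) m"
      by (simp add: q_def k_def fps_mult_nth atLeast0AtMost sum_negf)
  qed
  have "fps_deriv (k * s) = 0" by (simp add: ks)
  then have "k * fps_deriv s = k * (q * s)"
    by (simp add: dk algebra_simps)
  then have "(s * k) * fps_deriv s = (s * k) * (q * s)" by (simp only: mult.assoc)
  then have ds: "fps_deriv s = q * s" using ks by (simp add: mult.commute)
  have "fps_nth s n = newton 1 ?p n"
  proof (rule newton_unique)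
    have "fps_nth k 0 = 1" by (simp add: k_def lambda_op_newton[OF assms])
    moreover have "fps_nth (k * s) 0 = 1" by (simp add: ks)
    ultimately show "fps_nth s 0 = 1" by simp
    fix m
    have "fps_nth (fps_deriv s) m = fps_nth (q * s) m" by (simp only: ds)
    then show "of_nat (Suc m) * fps_nth s (Suc m) = (\<Sum>j\<le>m. 1 ^ j * ?p (Suc j) * fps_nth s (m - j))"
      by (simp add: q_def fps_mult_nth atLeast0AtMost)
  qed
  then show ?thesis by (simp add: s_def)
qed

section \<open>Exterior and symmetric powers of characters\<close>

text \<open>The compressed \<open>n\<close>-th tensor power of \<open>\<rho>\<close> is
  multiplicative by \<open>twisted_power_kcomp\<close> and has the required trace. At the identity
  it is the (anti)symmetrizer, hence the detour through \<open>kernel_rep_in_Cha\<close>.\<close>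

lemma newton_character:
  assumes G: "group G" and \<chi>: "\<chi> \<in> Cha G" and e: "e * e = 1"
  shows "(\<lambda>g. if g \<in> carrier G then newton e (\<lambda>j. \<chi> (g [^]\<^bsub>G\<^esub> j)) n else 0) \<in> Cha G"
proof -
  interpret G: group G by fact
  obtain d \<rho> where \<rho>: "\<rho> \<in> hom G (GL d)" and \<chi>_eq: "\<chi> = character_of G \<rho>"
    using \<chi> by (auto simp: Cha_def)
  note hom = \<rho>[unfolded GL_hom_iff[OF G]]
  define I where "I = {..<d}"
  define A where "A g = (\<lambda>v w. \<rho> g $$ (v, w))" for g
  have A_mult: "kcomp I (A g) (A h) v w = A (g \<otimes>\<^bsub>G\<^esub> h) v w"
    if "g \<in> carrier G" "h \<in> carrier G" "v \<in> I" "w \<in> I" for g h v w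
  proof -
    have "\<rho> g \<in> carrier_mat d d" "\<rho> h \<in> carrier_mat d d" using hom that by auto
    note this[THEN carrier_matD(1)] this[THEN carrier_matD(2)]
    then show ?thesis using hom that
      by (simp add: kcomp_def A_def I_def scalar_prod_def atLeast0LessThan)
  qed
  \<comment> \<open>\<open>B\<close> is compared with \<open>A h\<close> on \<open>I\<close> only,
    since kernel entries outside \<open>I\<close> carry no meaning; \<open>h\<close> and
    \<open>B\<close> vary because \<open>kpow\<close> accumulates in its last argument.\<close>
  have kpow: "ktrace I (kpow I (A g) j B) = ktrace I (A (g [^]\<^bsub>G\<^esub> j \<otimes>\<^bsub>G\<^esub> h))"
    if "g \<in> carrier G" "h \<in> carrier G" "\<And>v w. v \<in> I \<Longrightarrow> w \<in> I \<Longrightarrow> B v w = A h v w" for g h j B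
    using that(2,3)
  proof (induction j arbitrary: h B)
    case 0
    then show ?case by (simp add: ktrace_def)
  next
    case (Suc j)
    have "kcomp I (A g) B v w = A (g \<otimes>\<^bsub>G\<^esub> h) v w" if "v \<in> I" "w \<in> I" for v w
    proof -
      have "kcomp I (A g) B v w = kcomp I (A g) (A h) v w"
        using Suc.prems that by (simp add: kcomp_def)
      then show ?thesis using A_mult Suc.prems \<open>g \<in> carrier G\<close> that by simp
    qed
    from Suc.IH[OF _ this] Suc.prems \<open>g \<in> carrier G\<close> show ?case
      by (simp add: G.m_assoc)
  qed
  have power_trace: "ktrace I (kpow I (A g) (j - 1) (A g)) = \<chi> (g [^]\<^bsub>G\<^esub> j)" if g: "g \<in> carrier G" and "j > 0" for g j
  proof -
    have "ktrace I (kpow I (A g) (j - 1) (A g)) = ktrace I (A (g [^]\<^bsub>G\<^esub> j))"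
      using kpow[OF g g, of "A g" "j - 1"] \<open>j > 0\<close> by (cases j) auto
    moreover have "\<rho> (g [^]\<^bsub>G\<^esub> j) \<in> carrier_mat d d" using hom g by simp
    ultimately show ?thesis using g
      by (simp add: \<chi>_eq character_of_def mat_trace_def ktrace_def A_def I_def)
  qed
  have trace: "(\<Sum>s\<in>{..<n} \<rightarrow>\<^sub>E I. twisted_power e {..<n} (A g) s s) =
      newton e (\<lambda>j. \<chi> (g [^]\<^bsub>G\<^esub> j)) n" if "g \<in> carrier G" for g
  proof -
    have "(\<Sum>s\<in>{..<n} \<rightarrow>\<^sub>E I. twisted_power e {..<n} (A g) s s) =
        newton e (\<lambda>j. ktrace I (kpow I (A g) (j - 1) (A g))) n"
      using twisted_power_trace[OF e, of "{..<n}"] by simp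
    also have "\<dots> = newton e (\<lambda>j. \<chi> (g [^]\<^bsub>G\<^esub> j)) n"
      using power_trace[OF that] by (rule newton_cong)
    finally show ?thesis .
  qed
  have "(\<lambda>g. if g \<in> carrier G then \<Sum>s\<in>{..<n} \<rightarrow>\<^sub>E I. twisted_power e {..<n} (A g) s s else 0) \<in> Cha G"
  proof (rule kernel_rep_in_Cha[OF G, where K = "\<lambda>g. twisted_power e {..<n} (A g)"])
    show "finite ({..<n} \<rightarrow>\<^sub>E I)" by (simp add: I_def finite_PiE)
    fix g h s t
    assume gh: "g \<in> carrier G" "h \<in> carrier G" and st: "s \<in> {..<n} \<rightarrow>\<^sub>E I" "t \<in> {..<n} \<rightarrow>\<^sub>E I"
    \<comment> \<open>The indices \<open>s i\<close> and \<open>t (\<sigma> i)\<close> lie in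
      \<open>I\<close>, where \<open>A_mult\<close> applies.\<close>
    have "(\<Prod>i<n. kcomp I (A g) (A h) (s i) (t (\<sigma> i))) = (\<Prod>i<n. A (g \<otimes>\<^bsub>G\<^esub> h) (s i) (t (\<sigma> i)))"
      if "\<sigma> permutes {..<n}" for \<sigma>
      using st permutes_in_image[OF that] by (intro prod.cong refl A_mult gh) auto
    then show "twisted_power e {..<n} (A (g \<otimes>\<^bsub>G\<^esub> h)) s t =
        (\<Sum>u\<in>{..<n} \<rightarrow>\<^sub>E I. twisted_power e {..<n} (A g) s u * twisted_power e {..<n} (A h) u t)"
      by (subst twisted_power_kcomp[OF e]) (auto simp: I_def twisted_power_def)
  qed
  then show ?thesis by (simp add: trace cong: if_cong)
qed

lemma lambda_op_outside: "x \<notin> carrier G \<Longrightarrow> lambda_op G n f x = 0"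
  using lambda_series[of G f]
  by (simp add: lambda_op_def is_lambda_series_def Maps_fps_def Maps_def)

lemma sym_op_outside: "x \<notin> carrier G \<Longrightarrow> sym_op G n f x = 0"
  using sym_series(1)[of G f] by (simp add: sym_op_def Maps_fps_def Maps_def)

lemma lambda_op_in_Cha:
  assumes "group G" "\<chi> \<in> Cha G"
  shows "lambda_op G n \<chi> \<in> Cha G"
proof -
  have "lambda_op G n \<chi> =
      (\<lambda>g. if g \<in> carrier G then newton (- 1) (\<lambda>j. \<chi> (g [^]\<^bsub>G\<^esub> j)) n else 0)"
    by (auto simp: lambda_op_newton[OF assms(1)] lambda_op_outside)
  then show ?thesis using newton_character[OF assms, of "- 1" n] by simp
qed

lemma sym_op_in_Cha:
  assumes "group G" "\<chi> \<in> Cha G"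
  shows "sym_op G n \<chi> \<in> Cha G"
proof -
  have "sym_op G n \<chi> =
      (\<lambda>g. if g \<in> carrier G then newton 1 (\<lambda>j. \<chi> (g [^]\<^bsub>G\<^esub> j)) n else 0)"
    by (auto simp: sym_op_newton[OF assms(1)] sym_op_outside)
  then show ?thesis using newton_character[OF assms, of 1 n] by simp
qed

section \<open>Compatibility with the quotient map\<close>

lemma pullback_pow:
  assumes "N \<lhd> G" "x \<in> carrier G"
  shows "pullback G N f (x [^]\<^bsub>G\<^esub> (j :: nat)) = f (proj G N x [^]\<^bsub>G Mod N\<^esub> j)"
proof -
  interpret normal N G by fact
  show ?thesis using assms(2) by (simp add: pullback_def proj_def FactGroup_pow)
qed

lemma proj_in_FactGroup: "x \<in> carrier G \<Longrightarrow> proj G N x \<in> carrier (G Mod N)"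
  by (simp add: carrier_FactGroup proj_def)

text \<open>Both sides at \<open>x\<close> are the same Newton expression in the values of
  \<open>f\<close> at the powers of the coset of \<open>x\<close>.\<close>

lemma lambda_op_pullback:
  assumes "N \<lhd> G"
  shows "lambda_op G n (pullback G N f) = pullback G N (lambda_op (G Mod N) n f)"
proof
  interpret normal N G by fact
  fix x show "lambda_op G n (pullback G N f) x = pullback G N (lambda_op (G Mod N) n f) x"
    by (cases "x \<in> carrier G")
      (simp_all add: lambda_op_newton[OF group_axioms] lambda_op_newton[OF factorgroup_is_group]
        pullback_pow[OF assms] proj_in_FactGroup lambda_op_outside,
       simp_all add: pullback_def proj_in_FactGroup lambda_op_newton[OF factorgroup_is_group])
qed

lemma sym_op_pullback:
  assumes "N \<lhd> G"
  shows "sym_op G n (pullback G N f) = pullback G N (sym_op (G Mod N) n f)"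
proof
  interpret normal N G by fact
  fix x show "sym_op G n (pullback G N f) x = pullback G N (sym_op (G Mod N) n f) x"
    by (cases "x \<in> carrier G")
      (simp_all add: sym_op_newton[OF group_axioms] sym_op_newton[OF factorgroup_is_group]
        pullback_pow[OF assms] proj_in_FactGroup sym_op_outside,
       simp_all add: pullback_def proj_in_FactGroup sym_op_newton[OF factorgroup_is_group])
qed

text \<open>\<open>N\<close> is the fibre over the identity coset; this yields the condition on
  values in \<open>F\<close>.\<close>

lemma pullback_const_on:
  assumes "N \<lhd> G" "g \<in> N"
  shows "pullback G N f g = pullback G N f \<one>\<^bsub>G\<^esub>"
proof -
  interpret normal N G by fact
  show ?thesis using assms(2) rcos_const[of g] rcos_const[of "\<one>\<^bsub>G\<^esub>"]
    by (simp add: pullback_def proj_def is_subgroup mem_carrier)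
qed

section \<open>Inner products on the group and its quotient\<close>

lemma sum_proj_FactGroup:
  assumes "N \<lhd> G" "finite (carrier G)"
  shows "(\<Sum>g\<in>carrier G. h (proj G N g)) = of_nat (card N) * (\<Sum>X\<in>carrier (G Mod N). h X :: complex)"
proof -
  interpret normal N G by fact
  have X: "sum (\<lambda>g. h (proj G N g)) {g \<in> carrier G. proj G N g = X} = of_nat (card N) * h X"
    if "X \<in> carrier (G Mod N)" for X
  proof -
    have rc: "X \<in> rcosets\<^bsub>G\<^esub> N" using that by (simp add: FactGroup_def)
    then obtain y where y: "y \<in> carrier G" "X = N #>\<^bsub>G\<^esub> y" by (auto simp: RCOSETS_def)
    \<comment> \<open>The fibre over a coset is that coset itself, as a set of group
      elements.\<close>
    have "{g \<in> carrier G. proj G N g = X} = X"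
    proof (intro equalityI subsetI)
      fix g assume "g \<in> {g \<in> carrier G. proj G N g = X}"
      then show "g \<in> X" using rcos_self[OF _ is_subgroup, of g] by (auto simp: proj_def)
    next
      fix g assume g: "g \<in> X"
      then have "g \<in> carrier G" using y r_coset_subset_G[OF subset] by blast
      moreover have "N #>\<^bsub>G\<^esub> y = N #>\<^bsub>G\<^esub> g"
        using repr_independence[OF _ y(1) is_subgroup] g y(2) by blast
      ultimately show "g \<in> {g \<in> carrier G. proj G N g = X}" using y(2) by (simp add: proj_def)
    qed
    moreover have "card X = card N"
      using card_rcosets_equal[OF rc subset] by simp
    moreover have "sum (\<lambda>g. h (proj G N g)) {g \<in> carrier G. proj G N g = X} =
        (\<Sum>g | g \<in> carrier G \<and> proj G N g = X. h X)"
      by (intro sum.cong) auto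
    ultimately show ?thesis by simp
  qed
  have fin: "finite (carrier (G Mod N))" using assms(2) by (simp add: carrier_FactGroup)
  have "(\<Sum>g\<in>carrier G. h (proj G N g)) =
      (\<Sum>X\<in>carrier (G Mod N). sum (\<lambda>g. h (proj G N g)) {g \<in> carrier G. proj G N g = X})"
    using assms(2) fin proj_in_FactGroup by (intro sum.group[symmetric]) auto
  also have "\<dots> = (\<Sum>X\<in>carrier (G Mod N). of_nat (card N) * h X)"
    by (intro sum.cong refl X)
  finally show ?thesis by (simp add: sum_distrib_left)
qed

text \<open>The fibre size \<open>card N\<close> cancels against the normalizing factors by
  Lagrange's theorem.\<close>

lemma inner_prod_pullback:
  assumes "N \<lhd> G" "finite (carrier G)"
  shows "inner_prod G (pullback G N f) (pullback G N f') = inner_prod (G Mod N) f f'"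
proof -
  interpret normal N G by fact
  have "proj G N (inv\<^bsub>G\<^esub> g) = inv\<^bsub>G Mod N\<^esub> proj G N g" if "g \<in> carrier G" for g
    using that proj_in_FactGroup[OF that, of N]
    by (simp add: proj_def inv_FactGroup rcos_inv)
  then have "(\<Sum>g\<in>carrier G. pullback G N f g * pullback G N f' (inv\<^bsub>G\<^esub> g)) =
      (\<Sum>g\<in>carrier G. f (proj G N g) * f' (inv\<^bsub>G Mod N\<^esub> proj G N g))"
    by (intro sum.cong) (auto simp: pullback_def)
  also have "\<dots> = of_nat (card N) * (\<Sum>X\<in>carrier (G Mod N). f X * f' (inv\<^bsub>G Mod N\<^esub> X))"
    by (rule sum_proj_FactGroup[OF assms])
  finally have "(\<Sum>g\<in>carrier G. pullback G N f g * pullback G N f' (inv\<^bsub>G\<^esub> g)) =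
      of_nat (card N) * (\<Sum>X\<in>carrier (G Mod N). f X * f' (inv\<^bsub>G Mod N\<^esub> X))" .
  moreover have "card (carrier G) = card (carrier (G Mod N)) * card N"
    using lagrange[OF is_subgroup] by (simp add: FactGroup_def Coset.order_def)
  moreover have "card N > 0"
    using assms(2) subset one_closed
    by (metis card_gt_0_iff empty_iff finite_subset subgroup.one_closed is_subgroup)
  ultimately show ?thesis by (simp add: inner_prod_def)
qed

theorem theorem5p7p5:
  fixes G :: "('a, 'm) monoid_scheme"
    and N :: "'a set"
    and k' :: nat
    and \<phi> :: "nat \<Rightarrow> 'a set \<Rightarrow> complex"
    and \<chi> :: "'a \<Rightarrow> complex"
    and \<chi>' :: "'a set \<Rightarrow> complex"
  assumes "group G" and "finite (carrier G)" and "N \<lhd> G"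
    and "bij_betw \<phi> {1..k'} (Irr (G Mod N))"
    and "\<chi> \<in> F G N" and "\<chi>' \<in> Cha (G Mod N)" and "\<chi> = pullback G N \<chi>'"
  shows "(\<forall>i\<ge>1. lambda_op G i \<chi> \<in> F G N \<and> sym_op G i \<chi> \<in> F G N) \<and>
    (\<forall>i. \<forall>j\<in>{1..k'}.
       inner_prod G (pullback G N (\<phi> j)) (sym_op G i \<chi>) =
         inner_prod (G Mod N) (\<phi> j) (sym_op (G Mod N) i \<chi>') \<and>
       inner_prod G (pullback G N (\<phi> j)) (lambda_op G i \<chi>) =
         inner_prod (G Mod N) (\<phi> j) (lambda_op (G Mod N) i \<chi>'))"
proof -
  \<comment> \<open>Both operations stay in \<open>Cha G\<close>, and their values on
    \<open>N\<close> are constant because they are again pullbacks from the quotient.\<close>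
  have "lambda_op G i \<chi> \<in> F G N" "sym_op G i \<chi> \<in> F G N" for i
    using assms lambda_op_in_Cha[OF assms(1), of \<chi> i] sym_op_in_Cha[OF assms(1), of \<chi> i]
      pullback_const_on[OF assms(3)]
    by (auto simp: F_def lambda_op_pullback sym_op_pullback)
  then show ?thesis
    using assms by (simp add: lambda_op_pullback sym_op_pullback inner_prod_pullback)
qed

end
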